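(* Let $p$ be an odd prime, let $\lambda\in\mathbb{C}_p$ with $|\lambda|_p\ge1$, and let $a\in\frac{1}{\lambda}E$. Then \[ \int_{\mathbb{Z}_p}\sinh_\lambda(x:a)\,d\mu_{-1}(x)=-\tanh_\lambda\Big(\frac12:a\Big),\qquad \int_{\mathbb{Z}_p}\cosh_\lambda(x:a)\,d\mu_{-1}(x)=1. \]
   Context: $\mathbb{C}_p$ is the completion of an algebraic closure of $\mathbb{Q}_p$, with $|p|_p=1/p$; $\mathbb{Z}_p$ is the ring of $p$-adic integers. Let $E=\{x\in\mathbb{C}_p: |x|_p<p^{-1/(p-1)}\}$ and $\frac{1}{\lambda}E=\{t\in\mathbb{C}_p:\lambda t\in E\}$. Let $\log$ and $\exp$ denote the $p$-adic logarithm and exponential. For $a\in\frac1\lambda E$ and $|x|_p\le|\lambda|_p$, the degenerate exponential is $e^x_\lambda(a)=(1+\lambda a)^{x/\lambda}=\exp\big(\tfrac{x}{\lambda}\log(1+\lambda a)\big)=\sum_{n\ge0}(x)_{n,\lambda}\frac{a^n}{n!}$, where $(x)_{0,\lambda}=1$ and $(x)_{n,\lambda}=x(x-\lambda)\cdots(x-(n-1)\lambda)$ for $n\ge1$. The degenerate hyperbolic functions are $\cosh_\lambda(x:a)=\frac12\big(e^x_\lambda(a)+e^{-x}_\lambda(a)\big)$, $\sinh_\lambda(x:a)=\frac12\big(e^x_\lambda(a)-e^{-x}_\lambda(a)\big)$, and $\tanh_\lambda(x:a)=\sinh_\lambda(x:a)/\cosh_\lambda(x:a)$. The fermionic $p$-adic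 integral of a continuous $f:\mathbb{Z}_p\to\mathbb{C}_p$ is $\int_{\mathbb{Z}_p}f(x)\,d\mu_{-1}(x)=\lim_{N\to\infty}\sum_{x=0}^{p^N-1}f(x)(-1)^x$. *)

theory Defs
  imports "HOL-Analysis.Analysis" "HOL-Computational_Algebra.Computational_Algebra"
begin

text \<open>
  The library reserves \<open>norm\<close> for real normed vector spaces, hence a separate absolute value \<open>vabs\<close>.
\<close>

class ultrametric_field = field_char_0 + metric_space +
  fixes vabs :: "'a \<Rightarrow> real"
  assumes dist_vabs: "dist x y = vabs (x - y)"
    and vabs_mult: "vabs (x * y) = vabs x * vabs y"
    and vabs_add_le_max: "vabs (x + y) \<le> max (vabs x) (vabs y)"

class complete_ultrametric_field = ultrametric_field + complete_space

text \<open>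
  In a complete field extending \<open>\<rat>\<close> with its \<open>p\<close>-adic absolute value, the topological closure
  of \<open>\<rat>\<close> is the completion \<open>\<rat>\<^sub>p\<close>.
\<close>

definition padic_numbers :: "'a::{field_char_0, metric_space} set"
  where "padic_numbers = closure \<rat>"

definition padic_integers :: "'a::ultrametric_field set"
  where "padic_integers = {x \<in> padic_numbers. vabs x \<le> 1}"

definition algebraic_over :: "'a::field set \<Rightarrow> 'a set"
  where "algebraic_over F = {x. \<exists>f. f \<noteq> 0 \<and> (\<forall>i. coeff f i \<in> F) \<and> poly f x = 0}"

definition algebraically_closed_subset :: "'a::field set \<Rightarrow> bool"
  where "algebraically_closed_subset L \<longleftrightarrow>
    (\<forall>f. (\<forall>i. coeff f i \<in> L) \<and> degree f > 0 \<longrightarrow> (\<exists>x\<in>L. poly f x = 0))"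

text \<open>
  \<open>\<complex>\<^sub>p\<close> is determined only up to isometric isomorphism, so it is given by what makes a field a
  completion of an algebraic closure of \<open>\<rat>\<^sub>p\<close>. The condition on \<open>p\<close> forces \<^const>\<open>vabs\<close> to
  restrict to the \<open>p\<close>-adic absolute value on \<open>\<rat>\<close>. The last two conditions say that the elements
  algebraic over \<open>\<rat>\<^sub>p\<close> form an algebraic closure of \<open>\<rat>\<^sub>p\<close>, and that it is dense in the
  (complete) field.
\<close>

definition is_padic_complex_field :: "nat \<Rightarrow> 'a::complete_ultrametric_field itself \<Rightarrow> bool"
  where "is_padic_complex_field p K \<longleftrightarrow>
    prime p \<and>
    vabs (of_nat p :: 'a) = 1 / real p \<and>
    algebraically_closed_subset (algebraic_over (padic_numbers :: 'a set)) \<and>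
    closure (algebraic_over (padic_numbers :: 'a set)) = UNIV"

definition exp_domain :: "nat \<Rightarrow> 'a::ultrametric_field set"
  where "exp_domain p = {x. vabs x < real p powr (- 1 / (real p - 1))}"

definition scaled_exp_domain :: "nat \<Rightarrow> 'a::ultrametric_field \<Rightarrow> 'a set"
  where "scaled_exp_domain p l = {t. l * t \<in> exp_domain p}"

definition padic_exp :: "'a::{field_char_0, metric_space} \<Rightarrow> 'a"
  where "padic_exp x = (\<Sum>n. x ^ n / fact n)"

definition padic_log :: "'a::{field_char_0, metric_space} \<Rightarrow> 'a"
  where "padic_log y = (\<Sum>n. (-1) ^ n * (y - 1) ^ Suc n / of_nat (Suc n))"

definition degen_exp :: "'a::{field_char_0, metric_space} \<Rightarrow> 'a \<Rightarrow> 'a \<Rightarrow> 'a"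
  where "degen_exp l x a = padic_exp (x / l * padic_log (1 + l * a))"

definition degen_cosh :: "'a::{field_char_0, metric_space} \<Rightarrow> 'a \<Rightarrow> 'a \<Rightarrow> 'a"
  where "degen_cosh l x a = 1 / 2 * (degen_exp l x a + degen_exp l (- x) a)"

definition degen_sinh :: "'a::{field_char_0, metric_space} \<Rightarrow> 'a \<Rightarrow> 'a \<Rightarrow> 'a"
  where "degen_sinh l x a = 1 / 2 * (degen_exp l x a - degen_exp l (- x) a)"

definition degen_tanh :: "'a::{field_char_0, metric_space} \<Rightarrow> 'a \<Rightarrow> 'a \<Rightarrow> 'a"
  where "degen_tanh l x a = degen_sinh l x a / degen_cosh l x a"

text \<open>
  The integral is a relation, so that asserting its value includes that the integrand is continuous
  on \<open>\<int>\<^sub>p\<close> and that the defining limit exists.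
\<close>

definition has_fermionic_integral ::
    "nat \<Rightarrow> ('a::ultrametric_field \<Rightarrow> 'a) \<Rightarrow> 'a \<Rightarrow> bool"
  where "has_fermionic_integral p f I \<longleftrightarrow>
    continuous_on padic_integers f \<and>
    (\<lambda>N. \<Sum>x<p ^ N. f (of_nat x) * (-1) ^ x) \<longlonglongrightarrow> I"

end

theory Submission
  imports Defs
begin

text \<open>
  Put \<open>r = p\<^bsup>-1/(p-1)\<^esup>\<close>, so that \<open>r\<^bsup>p-1\<^esup> = |p|\<close>. Then \<open>|n!| \<ge> r\<^sup>n\<close> and \<open>|n| \<ge> r\<^bsup>n-1\<^esup>\<close>, so on the
  disc \<open>|x| < r\<close> the exponential converges, is a homomorphism and satisfies \<open>|exp x - 1| \<le> |x| / r\<close>,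
  while the logarithm maps \<open>1 + y\<close> back into the disc. As \<open>|\<lambda>| \<ge> 1\<close>, the number
  \<open>c = log (1 + \<lambda> a) / \<lambda>\<close> lies in the disc, and \<open>e\<^sub>\<lambda>\<^sup>x(a) = exp (c x)\<close> on \<open>\<int>\<^sub>p\<close>. With \<open>q = exp c\<close> the
  alternating sum of \<open>q\<^sup>x\<close> over \<open>x < p\<^sup>N\<close> is \<open>(1 + q\<^bsup>p^N\<^esup>) / (1 + q)\<close>, which tends to \<open>2 / (1 + q)\<close>.
  Both integrals follow by combining this value for \<open>c\<close> and for \<open>-c\<close>.
\<close>

section \<open>Ultrametric absolute values\<close>

lemma vabs_eq_dist_0: "vabs x = dist (x :: 'a::ultrametric_field) 0"
  by (simp add: dist_vabs)

lemma vabs_nonneg [simp]: "0 \<le> vabs (x :: 'a::ultrametric_field)"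
  by (simp add: vabs_eq_dist_0)

lemma vabs_eq_0_iff [simp]: "vabs (x :: 'a::ultrametric_field) = 0 \<longleftrightarrow> x = 0"
  by (simp add: vabs_eq_dist_0)

lemma vabs_0 [simp]: "vabs (0 :: 'a::ultrametric_field) = 0"
  by simp

lemma vabs_pos_iff [simp]: "0 < vabs (x :: 'a::ultrametric_field) \<longleftrightarrow> x \<noteq> 0"
  by (simp add: vabs_eq_dist_0)

lemma vabs_1 [simp]: "vabs (1 :: 'a::ultrametric_field) = 1"
  using vabs_mult[of "1::'a" 1] vabs_eq_0_iff[of "1::'a"] by simp

lemma vabs_minus_commute: "vabs (x - y) = vabs (y - x :: 'a::ultrametric_field)"
  by (metis dist_commute dist_vabs)

lemma vabs_minus [simp]: "vabs (- x) = vabs (x :: 'a::ultrametric_field)"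
  using vabs_minus_commute[of 0 x] by simp

lemma vabs_power: "vabs (x ^ n) = vabs (x :: 'a::ultrametric_field) ^ n"
  by (induction n) (simp_all add: vabs_mult)

lemma vabs_divide: "vabs (x / y) = vabs x / vabs (y :: 'a::ultrametric_field)"
proof (cases "y = 0")
  case False
  then have "vabs (x / y) * vabs y = vabs x"
    by (simp flip: vabs_mult)
  with False show ?thesis
    by (simp add: field_simps)
qed simp

lemma vabs_sum_le:
  fixes f :: "'b \<Rightarrow> 'a::ultrametric_field"
  assumes "\<And>i. i \<in> A \<Longrightarrow> vabs (f i) \<le> B" and "0 \<le> B"
  shows "vabs (sum f A) \<le> B"
  using assms(1)
proof (induction A rule: infinite_finite_induct)
  case (insert x F)
  then show ?case
    using vabs_add_le_max[of "f x" "sum f F"] by fastforce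
qed (simp_all add: \<open>0 \<le> B\<close>)

lemma vabs_of_nat_le_1: "vabs (of_nat n :: 'a::ultrametric_field) \<le> 1"
  using vabs_sum_le[of "{..<n}" "\<lambda>_. 1 :: 'a" 1] by simp

lemma vabs_of_int_le_1: "vabs (of_int k :: 'a::ultrametric_field) \<le> 1"
  by (cases k) (use vabs_of_nat_le_1[where 'a='a] in \<open>auto simp del: of_nat_Suc\<close>)

section \<open>Limits, continuity of the field operations, and series\<close>

lemma tendsto_iff_vabs:
  "(f \<longlongrightarrow> (L :: 'a::ultrametric_field)) F \<longleftrightarrow> ((\<lambda>x. vabs (f x - L)) \<longlongrightarrow> 0) F"
  by (subst tendsto_dist_iff) (simp add: dist_vabs)

text \<open>The error of a sum is at most the larger of the two errors, by the ultrametric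
  inequality. Together with the next instance this makes the general limit and continuity rules for
  sums and products applicable.\<close>

instance ultrametric_field \<subseteq> topological_ab_group_add
proof
  fix a b :: 'a
  show "((\<lambda>x. fst x + snd x) \<longlongrightarrow> a + b) (nhds a \<times>\<^sub>F nhds b)"
  proof (subst tendsto_iff_vabs, rule Lim_null_comparison)
    have "((\<lambda>x. max (vabs (fst x - a)) (vabs (snd x - b))) \<longlongrightarrow> max 0 0) (nhds a \<times>\<^sub>F nhds b)"
      using filterlim_fst[of "nhds a" "nhds b"] filterlim_snd[of "nhds b" "nhds a"]
      by (intro tendsto_max) (simp_all flip: tendsto_iff_vabs)
    then show "((\<lambda>x. max (vabs (fst x - a)) (vabs (snd x - b))) \<longlongrightarrow> 0) (nhds a \<times>\<^sub>F nhds b)"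
      by simp
    show "\<forall>\<^sub>F x in nhds a \<times>\<^sub>F nhds b. norm (vabs (fst x + snd x - (a + b)))
        \<le> max (vabs (fst x - a)) (vabs (snd x - b))"
      using vabs_add_le_max by (intro always_eventually allI) (simp add: add_diff_add)
  qed
next
  fix a :: 'a
  have "vabs (- x - - a) = vabs (x - a)" for x
    using vabs_minus[of "x - a"] by simp
  then show "(uminus \<longlongrightarrow> - a) (nhds a)"
    using filterlim_ident[of "nhds a"] by (simp only: tendsto_iff_vabs)
qed

instance ultrametric_field \<subseteq> topological_semigroup_mult
proof
  fix a b :: 'a
  have fst: "((\<lambda>x. vabs (fst x - a)) \<longlongrightarrow> 0) (nhds a \<times>\<^sub>F nhds b)"
    using filterlim_fst[of "nhds a" "nhds b"] by (simp flip: tendsto_iff_vabs)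
  have snd: "((\<lambda>x. vabs (snd x - b)) \<longlongrightarrow> 0) (nhds a \<times>\<^sub>F nhds b)"
    using filterlim_snd[of "nhds b" "nhds a"] by (simp flip: tendsto_iff_vabs)
  let ?g = "\<lambda>x. max (vabs (fst x - a) * vabs (snd x - b))
      (max (vabs (fst x - a) * vabs b) (vabs a * vabs (snd x - b)))"
  show "((\<lambda>x. fst x * snd x) \<longlongrightarrow> a * b) (nhds a \<times>\<^sub>F nhds b)"
  proof (subst tendsto_iff_vabs, rule Lim_null_comparison)
    have "(?g \<longlongrightarrow> max (0 * 0) (max (0 * vabs b) (vabs a * 0))) (nhds a \<times>\<^sub>F nhds b)"
      by (intro tendsto_max tendsto_mult fst snd tendsto_const)
    then show "(?g \<longlongrightarrow> 0) (nhds a \<times>\<^sub>F nhds b)"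
      by simp
    have "vabs (u * v - a * b) \<le> max (vabs (u - a) * vabs (v - b))
        (max (vabs (u - a) * vabs b) (vabs a * vabs (v - b)))" for u v
    proof -
      \<comment> \<open>Every summand contains a factor \<open>u - a\<close> or
        \<open>v - b\<close>, so all three bounds in \<open>?g\<close> tend to 0.\<close>
      have "u * v - a * b = (u - a) * (v - b) + ((u - a) * b + a * (v - b))"
        by (simp add: algebra_simps)
      then show ?thesis
        using vabs_add_le_max[of "(u - a) * (v - b)" "(u - a) * b + a * (v - b)"]
          vabs_add_le_max[of "(u - a) * b" "a * (v - b)"]
        by (simp add: vabs_mult)
    qed
    then show "\<forall>\<^sub>F x in nhds a \<times>\<^sub>F nhds b. norm (vabs (fst x * snd x - a * b)) \<le> ?g x"
      by (intro always_eventually allI) simp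
  qed
qed

text \<open>A block of consecutive terms is no larger than its largest term, so null terms already
  make the partial sums Cauchy, and completeness gives the limit.\<close>

lemma summable_if_vabs_null:
  fixes f :: "nat \<Rightarrow> 'a::complete_ultrametric_field"
  assumes "(\<lambda>n. vabs (f n)) \<longlonglongrightarrow> 0"
  shows "summable f"
  unfolding summable_iff_convergent
proof (rule Cauchy_convergent, rule CauchyI')
  fix e :: real
  assume "0 < e"
  \<comment> \<open>Halving \<open>e\<close> makes up for \<open>vabs_sum_le\<close> yielding only a
    weak inequality.\<close>
  then obtain M where M: "\<And>n. n \<ge> M \<Longrightarrow> vabs (f n) < e / 2"
    using order_tendstoD(2)[OF assms, of "e / 2"] by (auto simp: eventually_sequentially)
  have "dist (sum f {..<m}) (sum f {..<n}) < e" if "M \<le> m" "m < n" for m n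
  proof -
    have "sum f {..<n} = sum f {..<m} + sum f {m..<n}"
      using that sum.atLeastLessThan_concat[of 0 m n f] by (simp add: atLeast0LessThan)
    then have "dist (sum f {..<m}) (sum f {..<n}) = vabs (sum f {m..<n})"
      by (simp add: dist_vabs)
    also have "\<dots> \<le> e / 2"
      using that M \<open>0 < e\<close> by (intro vabs_sum_le) (auto intro!: less_imp_le)
    finally show ?thesis
      using \<open>0 < e\<close> by simp
  qed
  then show "\<exists>M. \<forall>m\<ge>M. \<forall>n>m. dist (sum f {..<m}) (sum f {..<n}) < e"
    by blast
qed

lemma vabs_suminf_le:
  fixes f :: "nat \<Rightarrow> 'a::complete_ultrametric_field"
  assumes "summable f" and "\<And>n. vabs (f n) \<le> B"
  shows "vabs (suminf f) \<le> B"
proof (rule LIMSEQ_le_const2)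
  show "(\<lambda>n. vabs (sum f {..<n})) \<longlonglongrightarrow> vabs (suminf f)"
    unfolding vabs_eq_dist_0 using summable_LIMSEQ[OF assms(1)] by (intro tendsto_dist) auto
  have "0 \<le> B"
    using assms(2)[of 0] vabs_nonneg[of "f 0"] by linarith
  then show "\<exists>N. \<forall>n\<ge>N. vabs (sum f {..<n}) \<le> B"
    using assms(2) by (intro exI allI impI vabs_sum_le)
qed

section \<open>The exponential and the logarithm\<close>

text \<open>This is the radius of convergence of the p-adic exponential series.\<close>

definition exp_radius :: "nat \<Rightarrow> real"
  where "exp_radius p = real p powr (- 1 / (real p - 1))"

lemma mem_exp_domain_iff: "x \<in> exp_domain p \<longleftrightarrow> vabs x < exp_radius p"
  by (simp add: exp_domain_def exp_radius_def)

text \<open>The parameter \<open>K\<close> carries the type \<open>'a\<close>, which otherwise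
  occurs only inside \<open>vabs_p\<close>, so that an interpretation can name it.\<close>

locale padic_valued_field =
  fixes p :: nat and K :: "'a::complete_ultrametric_field itself"
  assumes prime_p: "prime p" and vabs_p: "vabs (of_nat p :: 'a) = 1 / real p"
begin

abbreviation r :: real where "r \<equiv> exp_radius p"

section \<open>The radius \<open>r\<close> and the absolute values of integers and
  factorials\<close>

lemma p_gt_1: "p > 1"
  using prime_p prime_gt_1_nat by blast

lemma r_pos: "0 < r"
  using p_gt_1 by (simp add: exp_radius_def)

lemma r_less_1: "r < 1"
  using p_gt_1 by (simp add: exp_radius_def powr_less_one)

lemma r_power: "r ^ (p - 1) = vabs (of_nat p :: 'a)"
proof -
  have "r ^ (p - 1) = real p powr (- 1 / (real p - 1) * real (p - 1))"
    using p_gt_1 by (simp add: exp_radius_def powr_powr flip: powr_realpow)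
  also have "- 1 / (real p - 1) * real (p - 1) = - 1"
    using p_gt_1 by (simp add: of_nat_diff)
  finally show ?thesis
    using p_gt_1 by (simp add: vabs_p powr_minus inverse_eq_divide)
qed

lemma r_power_antimono: "m \<le> n \<Longrightarrow> r ^ n \<le> r ^ m"
  using r_pos r_less_1 by (intro power_decreasing) auto

text \<open>Bezout writes 1 as \<open>u * p + v * n\<close>. If \<open>n\<close> had absolute value
  below 1, both summands would, and hence so would 1.\<close>

lemma vabs_of_nat_eq_1:
  assumes "\<not> p dvd n"
  shows "vabs (of_nat n :: 'a) = 1"
proof (rule ccontr)
  assume "\<not> ?thesis"
  then have less: "vabs (of_nat n :: 'a) < 1"
    using vabs_of_nat_le_1[of n] by (metis less_le)
  have "coprime (int p) (int n)"
    using assms prime_p by (simp add: prime_imp_coprime)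
  then obtain u v where "u * int p + v * int n = 1"
    using bezout_int[of "int p" "int n"] by (auto simp: coprime_iff_gcd_eq_1)
  then have "of_int u * of_nat p + of_int v * of_nat n = (1 :: 'a)"
    by (metis of_int_1 of_int_add of_int_mult of_int_of_nat_eq)
  then have "1 \<le> max (vabs (of_int u * of_nat p :: 'a)) (vabs (of_int v * of_nat n :: 'a))"
    by (metis vabs_1 vabs_add_le_max)
  moreover have "vabs (of_int u * of_nat p :: 'a) \<le> 1 * vabs (of_nat p :: 'a)"
    unfolding vabs_mult by (intro mult_right_mono vabs_of_int_le_1) simp
  moreover have "vabs (of_int v * of_nat n :: 'a) \<le> 1 * vabs (of_nat n :: 'a)"
    unfolding vabs_mult by (intro mult_right_mono vabs_of_int_le_1) simp
  moreover have "vabs (of_nat p :: 'a) < 1"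
    using p_gt_1 by (simp add: vabs_p)
  ultimately show False
    using less by linarith
qed

text \<open>Splitting off a factor \<open>p\<close> costs exactly \<open>r ^ (p - 1)\<close>, and
  the rest is induction. The exponent \<open>n - 1\<close> instead of \<open>n\<close> is what later
  keeps the logarithm inside the disc.\<close>

lemma vabs_of_nat_ge: "n > 0 \<Longrightarrow> r ^ (n - 1) \<le> vabs (of_nat n :: 'a)"
proof (induction n rule: less_induct)
  case (less n)
  show ?case
  proof (cases "p dvd n")
    case False
    then show ?thesis
      using r_pos r_less_1 by (simp add: vabs_of_nat_eq_1 power_le_one)
  next
    case True
    then obtain m where m: "n = p * m"
      by blast
    with less.prems p_gt_1 have "0 < m" "m < n"
      by auto
    \<comment> \<open>Over the integers this says that \<open>(p - 1) * (m - 1)\<close> is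
      nonnegative; the successor forms remove the truncated subtraction.\<close>
    have "(p - 1) + (m - 1) \<le> n - 1"
    proof -
      obtain s t where "p = Suc s" "m = Suc t"
        using \<open>0 < m\<close> p_gt_1 by (metis gr0_implies_Suc less_trans zero_less_one)
      then show ?thesis
        by (simp add: m)
    qed
    then have "r ^ (n - 1) \<le> r ^ (p - 1) * r ^ (m - 1)"
      unfolding power_add[symmetric] by (rule r_power_antimono)
    also have "\<dots> \<le> vabs (of_nat p :: 'a) * vabs (of_nat m :: 'a)"
      unfolding r_power using less.IH[OF \<open>m < n\<close> \<open>0 < m\<close>] by (intro mult_left_mono) auto
    finally show ?thesis
      by (simp add: m vabs_mult)
  qed
qed

text \<open>Among the \<open>p\<close> factors that lead from \<open>fact (p * m)\<close> to
  \<open>fact (p * Suc m)\<close> only the last is divisible by \<open>p\<close>; it contributes the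
  absolute values of \<open>p\<close> and of \<open>Suc m\<close>. Iterated, this is Legendre's
  formula.\<close>

lemma vabs_fact_mult_p: "vabs (fact (p * m) :: 'a) = r ^ ((p - 1) * m) * vabs (fact m :: 'a)"
proof (induction m)
  case (Suc m)
  have step: "vabs (fact (p * m + j) :: 'a) = vabs (fact (p * m) :: 'a)" if "j < p" for j
    using that
  proof (induction j)
    case (Suc j)
    have "\<not> p dvd p * m + Suc j"
      using Suc.prems by (metis dvd_add_right_iff dvd_triv_left nat_dvd_not_less zero_less_Suc)
    from vabs_of_nat_eq_1[OF this] Suc show ?case
      by (simp add: vabs_mult del: of_nat_Suc of_nat_add)
  qed simp
  have "p * Suc m = Suc (p * m + (p - 1))"
    using p_gt_1 by simp
  then have "(fact (p * Suc m) :: 'a) = of_nat (p * Suc m) * fact (p * m + (p - 1))"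
    by (metis fact_Suc)
  then have "vabs (fact (p * Suc m) :: 'a)
      = vabs (of_nat (p * Suc m) :: 'a) * vabs (fact (p * m) :: 'a)"
    using step[of "p - 1"] p_gt_1 by (simp only: vabs_mult)
  then have "vabs (fact (p * Suc m) :: 'a)
      = r ^ (p - 1) * vabs (of_nat (Suc m) :: 'a) * vabs (fact (p * m) :: 'a)"
    by (simp only: of_nat_mult vabs_mult r_power)
  with Suc show ?case
    by (simp add: vabs_mult power_add del: of_nat_Suc)
qed simp

text \<open>If \<open>p\<close> divides \<open>n\<close>, the previous lemma reduces the claim to
  \<open>n div p\<close>. Otherwise the last factor of \<open>fact n\<close> is a unit, and the
  claim for \<open>n - 1\<close> is even stronger because \<open>r < 1\<close>.\<close>

lemma vabs_fact_ge: "r ^ n \<le> vabs (fact n :: 'a)"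
proof (induction n rule: less_induct)
  case (less n)
  consider "n = 0" | m where "n = p * m" "m > 0" | k where "n = Suc k" "\<not> p dvd n"
    by (metis dvdE gr0_conv_Suc gr_zeroI mult_0_right)
  then show ?case
  proof cases
    case (2 m)
    then have "m < n"
      using p_gt_1 by simp
    have "p = Suc (p - 1)"
      using p_gt_1 by simp
    then have "n = (p - 1) * m + m"
      using 2 by (metis add.commute mult_Suc)
    then have "r ^ n = r ^ ((p - 1) * m) * r ^ m"
      by (metis power_add)
    also have "\<dots> \<le> vabs (fact n :: 'a)"
      unfolding 2 vabs_fact_mult_p using less.IH[OF \<open>m < n\<close>] r_pos by (intro mult_left_mono) auto
    finally show ?thesis .
  next
    case (3 k)
    have "r ^ n \<le> r ^ k"
      using 3 by (intro r_power_antimono) simp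
    also have "\<dots> \<le> vabs (fact k :: 'a)"
      using less.IH 3 by simp
    also have "\<dots> = vabs (fact n :: 'a)"
      using vabs_of_nat_eq_1[OF 3(2)] 3(1) by (simp add: vabs_mult del: of_nat_Suc)
    finally show ?thesis .
  qed simp
qed

section \<open>The exponential on the disc of radius \<open>r\<close>\<close>

lemma vabs_exp_term_le: "vabs (x ^ n / fact n :: 'a) \<le> (vabs x / r) ^ n"
  unfolding vabs_divide vabs_power power_divide
  using r_pos by (intro divide_left_mono vabs_fact_ge mult_pos_pos) auto

lemma exp_ratio_bounds:
  assumes "vabs (x :: 'a) < r"
  shows "0 \<le> vabs x / r" "vabs x / r < 1"
  using assms r_pos by auto

lemma null_if_le_power:
  fixes f :: "nat \<Rightarrow> 'a"
  assumes "0 \<le> \<rho>" "\<rho> < 1" "\<And>n. vabs (f n) \<le> \<rho> ^ n"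
  shows "(\<lambda>n. vabs (f n)) \<longlonglongrightarrow> 0"
  using assms by (intro Lim_null_comparison[OF _ LIMSEQ_power_zero[of \<rho>]]) auto

lemma padic_exp_sums:
  assumes "vabs (x :: 'a) < r"
  shows "(\<lambda>n. x ^ n / fact n) sums padic_exp x"
  unfolding padic_exp_def
  using exp_ratio_bounds[OF assms] vabs_exp_term_le
  by (intro summable_sums summable_if_vabs_null null_if_le_power)

text \<open>Without its constant term the series has only terms bounded by positive powers of
  \<open>vabs x / r < 1\<close>, hence by the first power. This estimate gives nonvanishing and
  continuity of the exponential.\<close>

lemma vabs_padic_exp_minus_1_le:
  assumes "vabs (x :: 'a) < r"
  shows "vabs (padic_exp x - 1) \<le> vabs x / r"
proof -
  let ?f = "\<lambda>n. x ^ Suc n / fact (Suc n)"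
  have sums: "?f sums (padic_exp x - 1)"
    unfolding sums_def
  proof -
    have "(\<lambda>n. (\<Sum>k<Suc n. x ^ k / fact k) - 1) \<longlonglongrightarrow> padic_exp x - 1"
      using padic_exp_sums[OF assms] unfolding sums_def
      by (intro tendsto_diff tendsto_const LIMSEQ_Suc)
    then show "(\<lambda>n. sum ?f {..<n}) \<longlonglongrightarrow> padic_exp x - 1"
      by (simp only: sum.lessThan_Suc_shift) simp
  qed
  have "vabs (?f n) \<le> vabs x / r" for n
  proof -
    have "vabs (?f n) \<le> (vabs x / r) ^ Suc n"
      by (rule vabs_exp_term_le)
    also have "\<dots> \<le> (vabs x / r) ^ 1"
      using exp_ratio_bounds[OF assms] by (intro power_decreasing) auto
    finally show ?thesis
      by simp
  qed
  then have "vabs (suminf ?f) \<le> vabs x / r"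
    using sums_summable[OF sums] by (rule vabs_suminf_le[rotated])
  then show ?thesis
    using sums_unique[OF sums] by simp
qed

lemma vabs_padic_exp_minus_1_less:
  assumes "vabs (x :: 'a) < r"
  shows "vabs (padic_exp x - 1) < 1"
  using vabs_padic_exp_minus_1_le[OF assms] exp_ratio_bounds[OF assms] by linarith

lemma padic_exp_0: "padic_exp (0 :: 'a) = 1"
proof -
  have "vabs (padic_exp 0 - 1 :: 'a) \<le> 0"
    using vabs_padic_exp_minus_1_le[of 0] r_pos by simp
  then have "vabs (padic_exp 0 - 1 :: 'a) = 0"
    by (intro order.antisym vabs_nonneg)
  then show ?thesis
    by simp
qed

lemma vabs_add_less_r: "vabs (x :: 'a) < r \<Longrightarrow> vabs y < r \<Longrightarrow> vabs (x + y) < r"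
  using vabs_add_le_max[of x y] by linarith

text \<open>The product of the partial sums for \<open>x\<close> and \<open>y\<close> differs from
  the partial sum for \<open>x + y\<close> by the terms with \<open>i, j < n\<close> but
  \<open>i + j \<ge> n\<close>. Each is at most \<open>\<rho> ^ n\<close>, and so is their sum,
  however many there are.\<close>

lemma padic_exp_add:
  assumes x: "vabs (x :: 'a) < r" and y: "vabs y < r"
  shows "padic_exp (x + y) = padic_exp x * padic_exp y"
proof -
  \<comment> \<open>A common ratio below 1 that dominates the terms of both series.\<close>
  define \<rho> where "\<rho> = max (vabs x) (vabs y) / r"
  have \<rho>: "0 \<le> \<rho>" "\<rho> < 1"
    using x y r_pos by (auto simp: \<rho>_def le_max_iff_disj)
  define e :: "'a \<Rightarrow> nat \<Rightarrow> 'a" where "e z n = z ^ n / fact n" for z n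
  define S where "S z n = sum (e z) {..<n}" for z n
  have lim: "S z \<longlonglongrightarrow> padic_exp z" if "vabs z < r" for z
    using padic_exp_sums[OF that] by (simp add: sums_def S_def[abs_def] e_def[abs_def])
  have e_le: "vabs (e z n) \<le> \<rho> ^ n" if "vabs z \<le> max (vabs x) (vabs y)" for z n
  proof -
    have "vabs (e z n) \<le> (vabs z / r) ^ n"
      unfolding e_def by (rule vabs_exp_term_le)
    also have "\<dots> \<le> \<rho> ^ n"
      using that r_pos by (intro power_mono) (auto simp: \<rho>_def intro!: divide_right_mono)
    finally show ?thesis .
  qed
  \<comment> \<open>This is the binomial theorem divided by \<open>fact n\<close>.\<close>
  have e_add: "e (x + y) n = (\<Sum>i\<le>n. e x i * e y (n - i))" for n
    unfolding e_def binomial_ring sum_divide_distrib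
    by (intro sum.cong refl) (simp add: binomial_fact field_simps)
  let ?T = "\<lambda>n. {(i, j). i + j < n}" and ?Q = "\<lambda>n. {..<n} \<times> {..<n}"
  have T_sub: "?T n \<subseteq> ?Q n" for n :: nat
    by auto
  have diff: "S x n * S y n - S (x + y) n = (\<Sum>(i, j)\<in>?Q n - ?T n. e x i * e y j)" for n
  proof -
    have "S (x + y) n = (\<Sum>k<n. \<Sum>i\<le>k. e x i * e y (k - i))"
      by (simp add: S_def e_add)
    also have "\<dots> = (\<Sum>(i, j)\<in>?T n. e x i * e y j)"
      by (rule sum.triangle_reindex[symmetric])
    finally show ?thesis
      using T_sub[of n] by (simp add: S_def sum_product sum.cartesian_product sum_diff)
  qed
  have "vabs (S x n * S y n - S (x + y) n) \<le> \<rho> ^ n" for n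
    unfolding diff
  proof (rule vabs_sum_le)
    fix z
    assume "z \<in> ?Q n - ?T n"
    then obtain i j where z: "z = (i, j)" and "\<not> i + j < n"
      by auto
    have "vabs (e x i * e y j) \<le> \<rho> ^ i * \<rho> ^ j"
      unfolding vabs_mult using \<rho> by (intro mult_mono e_le) auto
    also have "\<dots> = \<rho> ^ (i + j)"
      by (simp add: power_add)
    also have "\<dots> \<le> \<rho> ^ n"
      using \<rho> \<open>\<not> i + j < n\<close> by (intro power_decreasing) auto
    finally show "vabs (case z of (i, j) \<Rightarrow> e x i * e y j) \<le> \<rho> ^ n"
      by (simp add: z)
  qed (use \<rho> in simp)
  from null_if_le_power[OF \<rho> this]
  have "(\<lambda>n. S x n * S y n - S (x + y) n) \<longlonglongrightarrow> 0"
    by (simp add: tendsto_iff_vabs)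
  moreover have "(\<lambda>n. S x n * S y n - S (x + y) n)
      \<longlonglongrightarrow> padic_exp x * padic_exp y - padic_exp (x + y)"
    using x y vabs_add_less_r[OF x y] by (intro tendsto_intros lim)
  ultimately show ?thesis
    using LIMSEQ_unique by fastforce
qed

lemma padic_exp_minus:
  assumes "vabs (x :: 'a) < r"
  shows "padic_exp (- x) = inverse (padic_exp x)"
  using padic_exp_add[of x "- x"] assms padic_exp_0 by (simp add: inverse_unique)

lemma padic_exp_nonzero:
  assumes "vabs (x :: 'a) < r"
  shows "padic_exp x \<noteq> 0"
  using vabs_padic_exp_minus_1_less[OF assms] by auto

lemma vabs_of_nat_mult_less_r: "vabs (x :: 'a) < r \<Longrightarrow> vabs (of_nat n * x) < r"
  using mult_right_mono[OF vabs_of_nat_le_1[of n, where 'a='a], of "vabs x"]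
  by (simp add: vabs_mult)

lemma padic_exp_of_nat_mult:
  assumes "vabs (x :: 'a) < r"
  shows "padic_exp (of_nat n * x) = padic_exp x ^ n"
proof (induction n)
  case (Suc n)
  have "padic_exp (of_nat (Suc n) * x) = padic_exp (x + of_nat n * x)"
    by (simp add: algebra_simps)
  then show ?case
    using Suc padic_exp_add[OF assms vabs_of_nat_mult_less_r[OF assms]] by simp
qed (simp add: padic_exp_0)

lemma vabs_padic_exp_le_1:
  assumes "vabs (x :: 'a) < r"
  shows "vabs (padic_exp x) \<le> 1"
  using vabs_add_le_max[of "padic_exp x - 1" 1] vabs_padic_exp_minus_1_less[OF assms] by simp

text \<open>By the addition law, \<open>padic_exp y - padic_exp x\<close> is
  \<open>padic_exp x * (padic_exp (y - x) - 1)\<close>, so the exponential is Lipschitz on the disc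
  with constant \<open>1 / r\<close>.\<close>

lemma continuous_on_padic_exp: "continuous_on (exp_domain p :: 'a set) padic_exp"
  unfolding continuous_on_def
proof
  fix x :: 'a
  assume "x \<in> exp_domain p"
  then have x: "vabs x < r"
    by (simp add: mem_exp_domain_iff)
  have bound: "vabs (padic_exp y - padic_exp x) \<le> vabs (y - x) / r" if "vabs y < r" for y
  proof -
    have yx: "vabs (y - x) < r"
      using vabs_add_less_r[of y "- x"] that x by simp
    have "padic_exp y = padic_exp x * padic_exp (y - x)"
      using padic_exp_add[OF x yx] by simp
    then have "padic_exp y - padic_exp x = padic_exp x * (padic_exp (y - x) - 1)"
      by (simp add: algebra_simps)
    then have "vabs (padic_exp y - padic_exp x) \<le> 1 * (vabs (y - x) / r)"
      unfolding vabs_mult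
      using vabs_padic_exp_le_1[OF x] vabs_padic_exp_minus_1_le[OF yx]
      by (simp only: vabs_mult) (intro mult_mono, auto)
    then show ?thesis
      by simp
  qed
  have "((\<lambda>y. vabs (y - x) / r) \<longlongrightarrow> 0 / r) (at x within exp_domain p)"
    using r_pos tendsto_ident_at[of x "exp_domain p"]
    by (intro tendsto_divide tendsto_const) (auto simp flip: tendsto_iff_vabs)
  then show "(padic_exp \<longlongrightarrow> padic_exp x) (at x within exp_domain p)"
    unfolding tendsto_iff_vabs[of padic_exp] using bound
    by (elim Lim_null_comparison[rotated, OF tendsto_eq_rhs])
      (auto simp: eventually_at_filter mem_exp_domain_iff)
qed

text \<open>Term \<open>n\<close> of the series has denominator \<open>Suc n\<close>, of absolute
  value at least \<open>r ^ n\<close>. This leaves a full factor \<open>vabs y\<close> in front of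
  the geometric bound, and the sum inherits the bound \<open>vabs y\<close>.\<close>

lemma vabs_padic_log_less_r:
  assumes "vabs (y :: 'a) < r"
  shows "vabs (padic_log (1 + y)) < r"
proof -
  let ?f = "\<lambda>n. (- 1) ^ n * y ^ Suc n / of_nat (Suc n)"
  let ?\<rho> = "vabs y / r"
  have le: "vabs (?f n) \<le> vabs y * ?\<rho> ^ n" for n
  proof -
    have "vabs (?f n) = vabs y ^ Suc n / vabs (of_nat (Suc n) :: 'a)"
      by (simp add: vabs_mult vabs_divide vabs_power del: of_nat_Suc)
    also have "\<dots> \<le> vabs y ^ Suc n / r ^ n"
      using vabs_of_nat_ge[of "Suc n"] r_pos
      by (intro divide_left_mono mult_pos_pos) (auto simp del: of_nat_Suc)
    also have "\<dots> = vabs y * ?\<rho> ^ n"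
      by (simp add: power_divide)
    finally show ?thesis .
  qed
  note \<rho> = exp_ratio_bounds[OF assms]
  \<comment> \<open>For convergence the factor \<open>vabs y < r < 1\<close> is dropped; for the
    size of the sum, below, the power of \<open>?\<rho>\<close> is dropped instead.\<close>
  have "vabs y * ?\<rho> ^ n \<le> ?\<rho> ^ n" for n
    using assms r_less_1 \<rho> by (intro mult_left_le_one_le) auto
  then have "vabs (?f n) \<le> ?\<rho> ^ n" for n
    using le order.trans by blast
  then have "summable ?f"
    using \<rho> by (intro summable_if_vabs_null null_if_le_power)
  moreover have "vabs y * ?\<rho> ^ n \<le> vabs y" for n
    using \<rho> by (intro mult_left_le power_le_one) auto
  then have "vabs (?f n) \<le> vabs y" for n
    using le order.trans by blast
  ultimately have "vabs (suminf ?f) \<le> vabs y"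
    by (rule vabs_suminf_le)
  then show ?thesis
    using assms by (simp add: padic_log_def)
qed

section \<open>Fermionic integrals of exponentials\<close>

lemma vabs_2:
  assumes "odd p"
  shows "vabs (2 :: 'a) = 1"
proof -
  have "\<not> p dvd 2"
    using assms p_gt_1 dvd_imp_le[of p 2] by (cases "p = 2") auto
  from vabs_of_nat_eq_1[OF this] show ?thesis
    by simp
qed

text \<open>Otherwise \<open>padic_exp x - 1\<close> would be \<open>-2\<close>, a unit for odd
  \<open>p\<close>, whereas its absolute value is below 1.\<close>

lemma one_plus_padic_exp_nonzero:
  assumes "odd p" "vabs (x :: 'a) < r"
  shows "1 + padic_exp x \<noteq> 0"
proof
  assume "1 + padic_exp x = 0"
  then have "padic_exp x - 1 = - 2"
    by (simp add: add_eq_0_iff)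
  then have "vabs (padic_exp x - 1) = 1"
    by (simp only: vabs_minus vabs_2[OF assms(1)])
  then show False
    using vabs_padic_exp_minus_1_less[OF assms(2)] by simp
qed

lemma of_nat_p_power_tendsto_0: "(\<lambda>N. of_nat (p ^ N) :: 'a) \<longlonglongrightarrow> 0"
proof -
  have "(\<lambda>N. (1 / real p) ^ N) \<longlonglongrightarrow> 0"
    using p_gt_1 by (intro LIMSEQ_power_zero) simp
  then show ?thesis
    by (simp add: tendsto_iff_vabs vabs_power vabs_p)
qed

lemma has_fermionic_integral_padic_exp:
  assumes "odd p" and c: "vabs (c :: 'a) < r"
  shows "has_fermionic_integral p (\<lambda>x. padic_exp (x * c)) (2 / (1 + padic_exp c))"
  unfolding has_fermionic_integral_def
proof
  have "vabs (x * c) < r" if "vabs x \<le> 1" for x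
    using mult_right_mono[OF that, of "vabs c"] c by (simp add: vabs_mult)
  then show "continuous_on padic_integers (\<lambda>x. padic_exp (x * c))"
    by (intro continuous_on_compose2[OF continuous_on_padic_exp] continuous_intros)
      (auto simp: padic_integers_def mem_exp_domain_iff)
next
  let ?q = "padic_exp c"
  have q: "1 + ?q \<noteq> 0"
    using assms by (rule one_plus_padic_exp_nonzero)
  have sum: "(\<Sum>x<p ^ N. padic_exp (of_nat x * c) * (- 1) ^ x)
      = (1 + padic_exp (of_nat (p ^ N) * c)) / (1 + ?q)" for N
  proof -
    have "(\<Sum>x<p ^ N. padic_exp (of_nat x * c) * (- 1) ^ x) = (\<Sum>x<p ^ N. (- ?q) ^ x)"
      using c by (intro sum.cong refl) (simp add: padic_exp_of_nat_mult power_minus[of ?q])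
    also have "\<dots> = (1 - (- ?q) ^ (p ^ N)) / (1 + ?q)"
      using q by (subst sum_gp_strict) (auto simp: neg_eq_iff_add_eq_0 add.commute)
    \<comment> \<open>Since \<open>p ^ N\<close> is odd, the sign survives and the numerator becomes
      \<open>1 + ?q ^ (p ^ N)\<close>.\<close>
    also have "(- ?q) ^ (p ^ N) = - (?q ^ (p ^ N))"
      using \<open>odd p\<close> by (intro power_minus_odd) simp
    finally show ?thesis
      using c by (simp only: padic_exp_of_nat_mult) simp
  qed
  \<comment> \<open>Written as an exponential, the power \<open>?q ^ (p ^ N)\<close> tends to 1 by
    continuity at 0, since \<open>p ^ N\<close> tends to 0 p-adically.\<close>
  have "(\<lambda>N. padic_exp (of_nat (p ^ N) * c)) \<longlonglongrightarrow> padic_exp (0 * c)"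
  proof (rule continuous_on_tendsto_compose[OF continuous_on_padic_exp])
    show "(\<lambda>N. of_nat (p ^ N) * c) \<longlonglongrightarrow> 0 * c"
      by (intro tendsto_mult of_nat_p_power_tendsto_0 tendsto_const)
    show "\<forall>\<^sub>F N in sequentially. of_nat (p ^ N) * c \<in> exp_domain p"
      unfolding mem_exp_domain_iff by (intro always_eventually allI vabs_of_nat_mult_less_r c)
  qed (use r_pos in \<open>simp add: mem_exp_domain_iff\<close>)
  \<comment> \<open>Division by the constant \<open>1 + ?q\<close> is written as multiplication by
    its inverse, so continuity of multiplication suffices.\<close>
  then have "(\<lambda>N. (1 + padic_exp (of_nat (p ^ N) * c)) * inverse (1 + ?q))
      \<longlonglongrightarrow> (1 + 1) * inverse (1 + ?q)"
    by (intro tendsto_mult tendsto_add tendsto_const) (simp add: padic_exp_0)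
  then show "(\<lambda>N. \<Sum>x<p ^ N. padic_exp (of_nat x * c) * (- 1) ^ x) \<longlonglongrightarrow> 2 / (1 + ?q)"
    unfolding sum by (simp add: divide_inverse)
qed

end

section \<open>Linearity of the integral, and the hyperbolic functions\<close>

lemma has_fermionic_integral_add:
  assumes "has_fermionic_integral p f I" and "has_fermionic_integral p g J"
  shows "has_fermionic_integral p (\<lambda>x. f x + g x) (I + J)"
  using assms unfolding has_fermionic_integral_def
  by (auto simp: distrib_right sum.distrib intro!: continuous_intros tendsto_intros)

lemma has_fermionic_integral_mult_left:
  assumes "has_fermionic_integral p f I"
  shows "has_fermionic_integral p (\<lambda>x. k * f x) (k * I)"
  using assms unfolding has_fermionic_integral_def
  by (auto simp: mult.assoc simp flip: sum_distrib_left intro!: continuous_intros tendsto_intros)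

theorem theorem6:
  fixes p :: nat and l a :: "'a::complete_ultrametric_field"
  assumes "prime p" and "odd p"
    and "is_padic_complex_field p TYPE('a)"
    and "vabs l \<ge> 1"
    and "a \<in> scaled_exp_domain p l"
  shows "has_fermionic_integral p (\<lambda>x. degen_sinh l x a) (- degen_tanh l (1 / 2) a) \<and>
         has_fermionic_integral p (\<lambda>x. degen_cosh l x a) 1"
proof -
  interpret padic_valued_field p "TYPE('a)"
    using assms(3) by unfold_locales (auto simp: is_padic_complex_field_def)
  define c where "c = padic_log (1 + l * a) / l"
  have "vabs (padic_log (1 + l * a)) < r"
    using assms(5)
    by (intro vabs_padic_log_less_r) (simp add: scaled_exp_domain_def mem_exp_domain_iff)
  \<comment> \<open>Dividing by \<open>l\<close> does not enlarge the absolute value, because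
    \<open>vabs l \<ge> 1\<close>.\<close>
  moreover have "vabs c \<le> vabs (padic_log (1 + l * a))"
    unfolding c_def vabs_divide
    using assms(4) mult_left_mono[OF assms(4), of "vabs (padic_log (1 + l * a))"]
    by (auto simp: divide_le_eq)
  ultimately have c: "vabs c < r"
    by linarith
  have degen_exp: "degen_exp l x a = padic_exp (x * c)" for x
    by (simp add: degen_exp_def c_def)
  define q where "q = padic_exp c"
  have q: "q \<noteq> 0" "1 + q \<noteq> 0"
    unfolding q_def using padic_exp_nonzero one_plus_padic_exp_nonzero \<open>odd p\<close> c by auto
  have pos: "has_fermionic_integral p (\<lambda>x. padic_exp (x * c)) (2 / (1 + q))"
    unfolding q_def using \<open>odd p\<close> c by (rule has_fermionic_integral_padic_exp)
  \<comment> \<open>The left side is the integral belonging to \<open>- c\<close>, as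
    \<open>padic_exp (- c)\<close> is \<open>inverse q\<close>.\<close>
  have "2 / (1 + inverse q) = 2 * q / (1 + q)"
    using q by (simp add: field_simps)
  then have neg: "has_fermionic_integral p (\<lambda>x. padic_exp (- x * c)) (2 * q / (1 + q))"
    using has_fermionic_integral_padic_exp[OF \<open>odd p\<close>, of "- c"] c
    by (simp add: padic_exp_minus q_def)

  define s where "s = padic_exp (1 / 2 * c)"
  \<comment> \<open>For odd \<open>p\<close> the number 2 is a unit, so halving \<open>c\<close>
    stays in the disc and \<open>s\<close> is a square root of \<open>q\<close>.\<close>
  have half: "vabs (1 / 2 * c) < r"
    using c vabs_2[OF \<open>odd p\<close>] by (simp add: vabs_divide)
  have s: "s \<noteq> 0" "q = s * s"
    using padic_exp_nonzero[OF half] padic_exp_add[OF half half] by (simp_all add: s_def q_def)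
  have "degen_exp l (1 / 2) a = s" "degen_exp l (- (1 / 2)) a = inverse s"
    using padic_exp_minus[OF half] by (simp_all add: degen_exp s_def)
  then have "degen_tanh l (1 / 2) a = (s - inverse s) / (s + inverse s)"
    by (simp only: degen_tanh_def degen_sinh_def degen_cosh_def mult_divide_mult_cancel_left_if) simp
  \<comment> \<open>Multiplying through by \<open>s\<close> turns \<open>s - inverse s\<close> and
    \<open>s + inverse s\<close> into \<open>q - 1\<close> and \<open>q + 1\<close>.\<close>
  also have "\<dots> = (s * (s - inverse s)) / (s * (s + inverse s))"
    using s(1) by simp
  also have "\<dots> = (q - 1) / (1 + q)"
    using s by (simp add: algebra_simps)
  \<comment> \<open>The value is put into the shape that linearity yields from \<open>pos\<close>
    and \<open>neg\<close>.\<close>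
  finally have tanh: "- degen_tanh l (1 / 2) a
      = 1 / 2 * (2 / (1 + q) + - 1 * (2 * q / (1 + q)))"
    by (simp add: ring_distribs diff_divide_distrib)

  have "has_fermionic_integral p (\<lambda>x. degen_sinh l x a) (- degen_tanh l (1 / 2) a)"
    unfolding tanh degen_sinh_def degen_exp diff_conv_add_uminus
    using has_fermionic_integral_mult_left[OF has_fermionic_integral_add[OF pos
        has_fermionic_integral_mult_left[OF neg, of "- 1"]], of "1 / 2"] by simp
  moreover have "1 / 2 * (2 / (1 + q) + 2 * q / (1 + q)) = 1"
    using q by (simp add: ring_distribs flip: add_divide_distrib)
  then have "has_fermionic_integral p (\<lambda>x. degen_cosh l x a) 1"
    unfolding degen_cosh_def degen_exp
    using has_fermionic_integral_mult_left[OF has_fermionic_integral_add[OF pos neg], of "1 / 2"]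
    by simp
  ultimately show ?thesis ..
qed

end
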